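(* Let $S$ be a set with operations $+,\cdot$ and relation $\le$ satisfying all axioms of a solid except possibly the distributivity axiom (AM4). Then the following are equivalent: (a) for all $x,y,z\in S$, $xy+xz=x(y+z)$ holds if and only if $e(x)(y+z)=e(x)y+e(x)z$ or $R(x)\le R(y)+R(z)$; (b) for all $x,y,z\in S$, $xy+xz=x(y+z)+e(x)y+e(x)z$.
   Context: A solid is a set $S$ with two binary operations $+$ and $\cdot$ (written $xy$) and a binary relation $\le$ satisfying the following axioms (all variables range over $S$). (A1) $+$ is associative and commutative. (A2) For each $x$ there is $e$ with $x+e=x$ such that $e+f=e$ for every $f$ with $x+f=x$; this $e$ is unique and is denoted $e(x)$ (the magnitude of $x$). An element $x$ with $x=e(x)$ is called a magnitude. (A3) For each $x$ there is $s$ with $x+s=e(x)$ and $e(s)=e(x)$; it is unique and denoted $-x$; write $x-y$ for $x+(-y)$. (A4) $e(x+y)=e(x)$ or $e(x+y)=e(y)$. (M1) $\cdot$ is associative and commutative. (M2) For each $x\neq e(x)$ there is $u$ with $xu=x$ such that $uv=u$ for every $v$ with $xv=x$; it is unique and denoted $u(x)$. (M3) For each $x\ne e(x)$ there is $d$ with $xd=u(x)$ and $u(d)=u(x)$; it is unique and denoted $x^{-1}$; write $y/x$ for $yx^{-1}$. (M4) If $x\neq e(x)$ and $y\ne e(y)$ then $u(xy)=u(x)$ or $u(xy)=u(y)$. (O1) $\le$ is a total order (reflexive, antisymmetric, transitive, total); $x<y$ means $x\le y$ and $x\ne y$. (O2) $x\le y\Rightarrow x+z\le y+z$. (O3) $y+e(x)=e(x)\Rightarrow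 (y\le e(x)$ and $-y\le e(x))$. (O4) $(e(x)<x$ and $y\le z)\Rightarrow xy\le xz$. (O5) $e(y)\le y\le z\Rightarrow e(x)y\le e(x)z$. (AM1) For all $x,y$ there is $z$ with $e(x)y=e(z)$. (AM2) $e(xy)=e(x)y+e(y)x$. (AM3) If $x\ne e(x)$ then $e(u(x))=e(x)/x$. (AM4) (distributivity axiom) $xy+xz=x(y+z)+e(x)y+e(x)z$. (AM5) $-(xy)=(-x)y$. (E1) There is $m$ with $m+x=x$ for all $x$; it is unique, called zero and denoted $0$. (E2) There is $u$ with $ux=x$ for all $x$; it is unique, called one and denoted $1$. (E3) There is $M$ with $e(x)+M=M$ for all $x$. (E4) There is $x$ with $e(x)\ne 0$ and $e(x)\ne M$. (E5) For every $x$ there is $a$ with $x=a+e(x)$ and $e(a)=0$. (E6) If $x,y$ are magnitudes with $x<y$, there is $z$ with $z\ne e(z)$ and $x<z<y$. Further notation: $S^*=\{x\in S: x\ne e(x)\}$ (zeroless elements). $x$ is positive if $e(x)\le x$ and negative if $x<e(x)$; $|x|=x$ if $x$ is positive and $|x|=-x$ if $x$ is negative. $x$ is precise if $e(x)=0$. The relative uncertainty $R(x)$ is $e(u(x))$ if $x\ne e(x)$, and $M$ (from (E3)) if $x=e(x)$. *)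

theory Defs
  imports Main
begin

type_synonym 'a op2 = "'a \<Rightarrow> 'a \<Rightarrow> 'a"

definition is_mag_of :: "'a op2 \<Rightarrow> 'a \<Rightarrow> 'a \<Rightarrow> bool" where
  "is_mag_of add x e \<longleftrightarrow> add x e = x \<and> (\<forall>f. add x f = x \<longrightarrow> add e f = e)"

definition mag :: "'a op2 \<Rightarrow> 'a \<Rightarrow> 'a" where
  "mag add x = (THE e. is_mag_of add x e)"

definition neg :: "'a op2 \<Rightarrow> 'a \<Rightarrow> 'a" where
  "neg add x = (THE s. add x s = mag add x \<and> mag add s = mag add x)"

definition is_unit_of :: "'a op2 \<Rightarrow> 'a \<Rightarrow> 'a \<Rightarrow> bool" where
  "is_unit_of mul x u \<longleftrightarrow> mul x u = x \<and> (\<forall>v. mul x v = x \<longrightarrow> mul u v = u)"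

definition unt :: "'a op2 \<Rightarrow> 'a \<Rightarrow> 'a" where
  "unt mul x = (THE u. is_unit_of mul x u)"

definition inv :: "'a op2 \<Rightarrow> 'a \<Rightarrow> 'a" where
  "inv mul x = (THE d. mul x d = unt mul x \<and> unt mul d = unt mul x)"

definition zero :: "'a op2 \<Rightarrow> 'a" where
  "zero add = (THE m. \<forall>x. add m x = x)"

definition bigM :: "'a op2 \<Rightarrow> 'a" where
  "bigM add = (SOME M. \<forall>x. add (mag add x) M = M)"

definition relunc :: "'a op2 \<Rightarrow> 'a op2 \<Rightarrow> 'a \<Rightarrow> 'a" where
  "relunc add mul x = (if x \<noteq> mag add x then mag add (unt mul x) else bigM add)"

definition solid_wo_dist :: "'a op2 \<Rightarrow> 'a op2 \<Rightarrow> ('a \<Rightarrow> 'a \<Rightarrow> bool) \<Rightarrow> bool" where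
  "solid_wo_dist add mul le \<longleftrightarrow>
    (let e = mag add; ng = neg add; u = unt mul; iv = inv mul;
         lt = (\<lambda>a b. le a b \<and> a \<noteq> b) in
    \<comment> \<open>A1\<close>
    (\<forall>x y z. add (add x y) z = add x (add y z)) \<and> (\<forall>x y. add x y = add y x) \<and>
    \<comment> \<open>A2\<close>
    (\<forall>x. \<exists>!e'. is_mag_of add x e') \<and>
    \<comment> \<open>A3\<close>
    (\<forall>x. \<exists>!s. add x s = e x \<and> e s = e x) \<and>
    \<comment> \<open>A4\<close>
    (\<forall>x y. e (add x y) = e x \<or> e (add x y) = e y) \<and>
    \<comment> \<open>M1\<close>
    (\<forall>x y z. mul (mul x y) z = mul x (mul y z)) \<and> (\<forall>x y. mul x y = mul y x) \<and>
    \<comment> \<open>M2\<close>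
    (\<forall>x. x \<noteq> e x \<longrightarrow> (\<exists>!u'. is_unit_of mul x u')) \<and>
    \<comment> \<open>M3\<close>
    (\<forall>x. x \<noteq> e x \<longrightarrow> (\<exists>!d. mul x d = u x \<and> u d = u x)) \<and>
    \<comment> \<open>M4\<close>
    (\<forall>x y. x \<noteq> e x \<and> y \<noteq> e y \<longrightarrow> u (mul x y) = u x \<or> u (mul x y) = u y) \<and>
    \<comment> \<open>O1\<close>
    (\<forall>x. le x x) \<and> (\<forall>x y. le x y \<and> le y x \<longrightarrow> x = y) \<and>
    (\<forall>x y z. le x y \<and> le y z \<longrightarrow> le x z) \<and> (\<forall>x y. le x y \<or> le y x) \<and>
    \<comment> \<open>O2\<close>
    (\<forall>x y z. le x y \<longrightarrow> le (add x z) (add y z)) \<and>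
    \<comment> \<open>O3\<close>
    (\<forall>x y. add y (e x) = e x \<longrightarrow> le y (e x) \<and> le (ng y) (e x)) \<and>
    \<comment> \<open>O4\<close>
    (\<forall>x y z. lt (e x) x \<and> le y z \<longrightarrow> le (mul x y) (mul x z)) \<and>
    \<comment> \<open>O5\<close>
    (\<forall>x y z. le (e y) y \<and> le y z \<longrightarrow> le (mul (e x) y) (mul (e x) z)) \<and>
    \<comment> \<open>AM1\<close>
    (\<forall>x y. \<exists>z. mul (e x) y = e z) \<and>
    \<comment> \<open>AM2\<close>
    (\<forall>x y. e (mul x y) = add (mul (e x) y) (mul (e y) x)) \<and>
    \<comment> \<open>AM3\<close>
    (\<forall>x. x \<noteq> e x \<longrightarrow> e (u x) = mul (e x) (iv x)) \<and>
    \<comment> \<open>AM5\<close>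
    (\<forall>x y. ng (mul x y) = mul (ng x) y) \<and>
    \<comment> \<open>E1\<close>
    (\<exists>!m. \<forall>x. add m x = x) \<and>
    \<comment> \<open>E2\<close>
    (\<exists>!one. \<forall>x. mul one x = x) \<and>
    \<comment> \<open>E3\<close>
    (\<exists>M. \<forall>x. add (e x) M = M) \<and>
    \<comment> \<open>E4\<close>
    (\<exists>x. e x \<noteq> zero add \<and> e x \<noteq> bigM add) \<and>
    \<comment> \<open>E5\<close>
    (\<forall>x. \<exists>a. x = add a (e x) \<and> e a = zero add) \<and>
    \<comment> \<open>E6\<close>
    (\<forall>x y. x = e x \<and> y = e y \<and> lt x y \<longrightarrow> (\<exists>z. z \<noteq> e z \<and> lt x z \<and> lt z y)))"

end

(* Write x = a + A and y = b + B, z = c + C, with a, b, c precise and A, B, C magnitudes.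
   Each of the two conditions makes multiplication distribute over addition on precise
   elements, so these form an ordered field, in which halving is available. Hence E2 = E for
   every magnitude E (otherwise some precise b has E < b <= E2, so b/2 <= E and
   b = b/2 + b/2 <= E), and therefore E(c + C) = Ec + EC and E(y + z) <= Ey + Ez.

   If the criterion holds, its first alternative yields xw = aw + Aw and
   a(y + z) = ay + az, and A(y + z) <= Ay + Az gives the distributivity axiom.
   Conversely, under the axiom xy + xz = x(y + z) means that Ay + Az is absorbed by the
   magnitude A(y + z) + xB + xC of x(y + z). If A(y + z) differs from Ay + Az, then y and z are
   zeroless and Ay = Az, so that Ay <= xB or Ay <= xC; for zeroless x, y the inequality
   Ay <= xB is equivalent to R(x) <= R(y). *)

theory Submission
  imports Defs
begin

locale predistributive_solid =
  fixes add :: "'a \<Rightarrow> 'a \<Rightarrow> 'a" (infixl "\<oplus>" 65)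
    and mul :: "'a \<Rightarrow> 'a \<Rightarrow> 'a" (infixl "\<odot>" 70)
    and le :: "'a \<Rightarrow> 'a \<Rightarrow> bool" (infix "\<preceq>" 50)
  assumes solid: "solid_wo_dist add mul le"
begin

abbreviation e :: "'a \<Rightarrow> 'a" where "e \<equiv> mag add"
abbreviation ng :: "'a \<Rightarrow> 'a" where "ng \<equiv> neg add"
abbreviation u :: "'a \<Rightarrow> 'a" where "u \<equiv> unt mul"
abbreviation iv :: "'a \<Rightarrow> 'a" where "iv \<equiv> Defs.inv mul"
abbreviation lt :: "'a \<Rightarrow> 'a \<Rightarrow> bool" (infix "\<prec>" 50) where "x \<prec> y \<equiv> x \<preceq> y \<and> x \<noteq> y"
abbreviation zer :: 'a ("\<zero>") where "\<zero> \<equiv> zero add"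
definition one :: 'a ("\<one>") where "\<one> = (THE w. \<forall>x. w \<odot> x = x)"

text \<open>The formulas stay closed so that each matches a conjunct of the definition literally;
  the attributes then turn them into rules.\<close>

lemma add_assoc [rule_format]: "\<forall>x y z. (x \<oplus> y) \<oplus> z = x \<oplus> (y \<oplus> z)"
  and add_comm [rule_format]: "\<forall>x y. x \<oplus> y = y \<oplus> x"
  and mag_ex1 [rule_format]: "\<forall>x. \<exists>!e'. is_mag_of add x e'"
  and neg_ex1 [rule_format]: "\<forall>x. \<exists>!s. x \<oplus> s = e x \<and> e s = e x"
  and mag_add_cases [rule_format]: "\<forall>x y. e (x \<oplus> y) = e x \<or> e (x \<oplus> y) = e y"
  and mul_assoc [rule_format]: "\<forall>x y z. (x \<odot> y) \<odot> z = x \<odot> (y \<odot> z)"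
  and mul_comm [rule_format]: "\<forall>x y. x \<odot> y = y \<odot> x"
  and unit_ex1 [rule_format]: "\<forall>x. x \<noteq> e x \<longrightarrow> (\<exists>!u'. is_unit_of mul x u')"
  and inv_ex1 [rule_format]: "\<forall>x. x \<noteq> e x \<longrightarrow> (\<exists>!d. x \<odot> d = u x \<and> u d = u x)"
  and le_refl [rule_format, simp]: "\<forall>x. x \<preceq> x"
  and le_antisym [rule_format, OF conjI]: "\<forall>x y. x \<preceq> y \<and> y \<preceq> x \<longrightarrow> x = y"
  and le_trans [rule_format, OF conjI, trans]: "\<forall>x y z. x \<preceq> y \<and> y \<preceq> z \<longrightarrow> x \<preceq> z"
  and le_total [rule_format]: "\<forall>x y. x \<preceq> y \<or> y \<preceq> x"
  and add_right_mono [rule_format]: "\<forall>x y z. x \<preceq> y \<longrightarrow> x \<oplus> z \<preceq> y \<oplus> z"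
  and absorbed_abs_le [rule_format]:
    "\<forall>x y. y \<oplus> e x = e x \<longrightarrow> y \<preceq> e x \<and> ng y \<preceq> e x"
  and mul_left_mono [rule_format, OF conjI]:
    "\<forall>x y z. e x \<prec> x \<and> y \<preceq> z \<longrightarrow> x \<odot> y \<preceq> x \<odot> z"
  and mag_mul_mono [rule_format, OF conjI]:
    "\<forall>x y z. e y \<preceq> y \<and> y \<preceq> z \<longrightarrow> e x \<odot> y \<preceq> e x \<odot> z"
  and mag_mul_is_mag [rule_format]: "\<forall>x y. \<exists>z. e x \<odot> y = e z"
  and mag_mul [rule_format]: "\<forall>x y. e (x \<odot> y) = e x \<odot> y \<oplus> e y \<odot> x"
  and mag_unit [rule_format]: "\<forall>x. x \<noteq> e x \<longrightarrow> e (u x) = e x \<odot> iv x"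
  and neg_mul [rule_format]: "\<forall>x y. ng (x \<odot> y) = ng x \<odot> y"
  and zero_ex1: "\<exists>!m. \<forall>x. m \<oplus> x = x"
  and one_ex1: "\<exists>!w. \<forall>x. w \<odot> x = x"
  and bigM_ex: "\<exists>M. \<forall>x. e x \<oplus> M = M"
  and mag_nontrivial: "\<exists>x. e x \<noteq> \<zero> \<and> e x \<noteq> bigM add"
  and precise_decomp [rule_format]: "\<forall>x. \<exists>a. x = a \<oplus> e x \<and> e a = \<zero>"
  and mag_dense [rule_format, OF conjI [OF _ conjI]]:
    "\<forall>x y. x = e x \<and> y = e y \<and> x \<prec> y \<longrightarrow> (\<exists>z. z \<noteq> e z \<and> x \<prec> z \<and> z \<prec> y)"
  using solid[unfolded solid_wo_dist_def Let_def] by - (elim conjE, assumption)+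

section \<open>Additive structure: magnitudes and additive inverses\<close>

lemma add_left_comm: "x \<oplus> (y \<oplus> z) = y \<oplus> (x \<oplus> z)"
  by (metis add_assoc add_comm)

lemmas add_ac = add_assoc add_comm add_left_comm

lemma mul_left_comm: "x \<odot> (y \<odot> z) = y \<odot> (x \<odot> z)"
  by (metis mul_assoc mul_comm)

lemmas mul_ac = mul_assoc mul_comm mul_left_comm

lemma is_mag_of_mag: "is_mag_of add x (e x)"
  unfolding mag_def by (rule theI') (rule mag_ex1)

lemma add_mag [simp]: "x \<oplus> e x = x"
  using is_mag_of_mag by (simp add: is_mag_of_def)

lemma mag_absorbs: "x \<oplus> f = x \<Longrightarrow> e x \<oplus> f = e x"
  using is_mag_of_mag by (simp add: is_mag_of_def)

lemma mag_add_self [simp]: "e x \<oplus> e x = e x"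
  by (simp add: mag_absorbs)

lemma mag_eqI: "is_mag_of add x f \<Longrightarrow> e x = f"
  using mag_ex1 is_mag_of_mag by blast

lemma mag_mag [simp]: "e (e x) = e x"
  by (rule mag_eqI) (simp add: is_mag_of_def)

lemma absorb_iff: "x \<oplus> f = x \<longleftrightarrow> e x \<oplus> f = e x"
  by (metis add_mag add_assoc mag_absorbs)

text \<open>The sum absorbs both magnitudes, and by A4 its own magnitude is one of them.\<close>

lemma mag_add: "e (x \<oplus> y) = e x \<oplus> e y"
proof -
  have "e (x \<oplus> y) \<oplus> e x = e (x \<oplus> y)" "e (x \<oplus> y) \<oplus> e y = e (x \<oplus> y)"
    by (rule mag_absorbs; metis add_mag add_ac)+
  then show ?thesis using mag_add_cases[of x y] add_comm by metis
qed

lemma add_neg [simp]: "x \<oplus> ng x = e x" and mag_neg [simp]: "e (ng x) = e x"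
  using theI'[OF neg_ex1[of x]] by (simp_all add: neg_def)

lemma mag_add_neg [simp]: "e x \<oplus> ng x = ng x"
  using add_mag[of "ng x"] add_comm[of "ng x" "e x"] by simp

lemma neg_eqI: "x \<oplus> s = e x \<Longrightarrow> e s = e x \<Longrightarrow> ng x = s"
  using neg_ex1[of x] add_neg mag_neg by blast

lemma neg_neg [simp]: "ng (ng x) = x"
  by (rule neg_eqI) (simp_all add: add_comm[of "ng x"])

lemma neg_mag [simp]: "ng (e x) = e x"
  by (rule neg_eqI) simp_all

lemma neg_add: "ng (x \<oplus> y) = ng x \<oplus> ng y"
proof (rule neg_eqI)
  have "x \<oplus> y \<oplus> (ng x \<oplus> ng y) = (x \<oplus> ng x) \<oplus> (y \<oplus> ng y)" by (simp only: add_ac)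
  then show "x \<oplus> y \<oplus> (ng x \<oplus> ng y) = e (x \<oplus> y)" by (simp add: mag_add)
qed (simp add: mag_add)

lemma mul_neg: "x \<odot> ng y = ng (x \<odot> y)"
  by (metis neg_mul mul_comm)

lemma add_zero [simp]: "\<zero> \<oplus> x = x" "x \<oplus> \<zero> = x"
  using theI'[OF zero_ex1] add_comm by (metis zero_def)+

lemma mag_zero [simp]: "e \<zero> = \<zero>"
  using add_mag[of \<zero>] unfolding add_zero .

lemma mul_one [simp]: "\<one> \<odot> x = x" "x \<odot> \<one> = x"
  using theI'[OF one_ex1] mul_comm unfolding one_def by metis+

lemma add_left_mono: "x \<preceq> y \<Longrightarrow> z \<oplus> x \<preceq> z \<oplus> y"
  using add_right_mono add_comm by metis

lemma add_mono: "x \<preceq> y \<Longrightarrow> z \<preceq> w \<Longrightarrow> x \<oplus> z \<preceq> y \<oplus> w"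
  using add_right_mono add_left_mono le_trans by metis

section \<open>Order: sums of magnitudes as maxima, and signs\<close>

lemma mag_sum_cases: "e x = x \<Longrightarrow> e y = y \<Longrightarrow> x \<oplus> y = x \<or> x \<oplus> y = y"
  using mag_add_cases[of x y] by (simp add: mag_add)

text \<open>By A4 one magnitude absorbs the other, and O3 turns absorption into order.\<close>

lemma mag_max:
  assumes "e x = x" "e y = y"
  shows "x \<preceq> y \<and> x \<oplus> y = y \<or> y \<preceq> x \<and> x \<oplus> y = x"
  using mag_sum_cases[OF assms] absorbed_abs_le[of x y] absorbed_abs_le[of y x] assms
  by (auto simp: add_comm)

lemma mag_le_iff:
  assumes "e x = x" "e y = y"
  shows "x \<preceq> y \<longleftrightarrow> x \<oplus> y = y"
  using mag_max[OF assms] le_antisym[of x y] by auto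

lemma mag_le_addI:
  assumes "e x = x" "e y = y"
  shows "x \<preceq> x \<oplus> y" "y \<preceq> x \<oplus> y"
  using mag_max[OF assms] by auto

lemma mag_add_le_iff:
  assumes "e x = x" "e y = y"
  shows "x \<oplus> y \<preceq> z \<longleftrightarrow> x \<preceq> z \<and> y \<preceq> z"
  using mag_max[OF assms] le_trans[of x y z] le_trans[of y x z] by auto

lemma le_mag_add_iff:
  assumes "e x = x" "e y = y"
  shows "z \<preceq> x \<oplus> y \<longleftrightarrow> z \<preceq> x \<or> z \<preceq> y"
  using mag_max[OF assms] le_trans[of z x y] le_trans[of z y x] by auto

lemma zero_le_mag: "e x = x \<Longrightarrow> \<zero> \<preceq> x"
  by (simp add: mag_le_iff)

text \<open>This turns an identity between sums into an inequality between magnitudes.\<close>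

lemma add_mag_absorb: "e f = f \<Longrightarrow> x \<oplus> f = x \<longleftrightarrow> f \<preceq> e x"
  by (simp add: absorb_iff[of x f] mag_le_iff add_comm[of f])

lemma pos_iff: "e x \<preceq> x \<longleftrightarrow> \<zero> \<preceq> x"
proof
  assume "\<zero> \<preceq> x"
  then show "e x \<preceq> x" using add_right_mono[of \<zero> x "e x"] by simp
next
  assume "e x \<preceq> x"
  with zero_le_mag[of "e x"] show "\<zero> \<preceq> x" by (simp add: le_trans[of \<zero> "e x" x])
qed

lemma nonneg_if_mag_le: "e f = f \<Longrightarrow> f \<preceq> x \<Longrightarrow> \<zero> \<preceq> x"
  using zero_le_mag[of f] le_trans[of \<zero> f x] by simp

lemma pos_if_mag_less: "e f = f \<Longrightarrow> f \<prec> x \<Longrightarrow> \<zero> \<prec> x"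
  using zero_le_mag[of f] nonneg_if_mag_le[of f x] le_antisym[of f \<zero>] by auto

lemma mag_le_neg_if_le_mag: "x \<preceq> e x \<Longrightarrow> e x \<preceq> ng x"
  using add_right_mono[of x "e x" "ng x"] by simp

lemma neg_le_mag_if_mag_le: "e x \<preceq> x \<Longrightarrow> ng x \<preceq> e x"
  using add_right_mono[of "e x" x "ng x"] by simp

text \<open>Adding \<open>f\<close> throughout squeezes the sum between \<open>f\<close> and
  \<open>f\<close> plus itself, which is \<open>f\<close>.\<close>

lemma absorbed_if_le:
  assumes "e f = f" "\<zero> \<preceq> y" "y \<preceq> f" shows "y \<oplus> f = f"
  using assms add_right_mono[of \<zero> y f] add_right_mono[of y f f] le_antisym
  by (metis add_zero(1) mag_add_self)

section \<open>Products with magnitudes\<close>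

lemma mag_mul_mag: "e x = x \<Longrightarrow> e (x \<odot> y) = x \<odot> y"
  by (metis mag_mul_is_mag mag_mag)

lemma mag_mul_mag': "e y = y \<Longrightarrow> e (x \<odot> y) = x \<odot> y"
  by (metis mag_mul_mag mul_comm)

text \<open>Such a product is a magnitude, hence its own negative: magnitudes do not see
  signs.\<close>

lemma mag_mul_neg: "e x = x \<Longrightarrow> x \<odot> ng y = x \<odot> y"
  by (metis mag_mul_mag mul_neg neg_mag)

lemma mag_mul_left_mono:
  assumes "e f = f" "\<zero> \<preceq> y" "y \<preceq> z" shows "f \<odot> y \<preceq> f \<odot> z"
  using assms mag_mul_mono[of y z f] pos_iff by simp

text \<open>For zeroless negative \<open>x\<close>, O4 is applied to \<open>ng x\<close>, whose
  products with magnitudes are the same.\<close>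

lemma mul_mag_mono:
  assumes "e f = f" "e g = g" "f \<preceq> g" shows "x \<odot> f \<preceq> x \<odot> g"
proof (cases "e x = x")
  case True
  then show ?thesis using mag_mul_left_mono zero_le_mag assms by simp
next
  case False
  show ?thesis
  proof (cases "e x \<preceq> x")
    case True
    then show ?thesis using mul_left_mono assms False by auto
  next
    case False
    with le_total have "x \<preceq> e x" by blast
    then have "e (ng x) \<preceq> ng x" using mag_le_neg_if_le_mag by simp
    moreover have "e (ng x) \<noteq> ng x" using False by (metis le_refl mag_neg neg_mag neg_neg)
    ultimately have "ng x \<odot> f \<preceq> ng x \<odot> g" using mul_left_mono assms by auto
    then show ?thesis using assms by (simp add: mul_comm[of _ f] mul_comm[of _ g] mag_mul_neg)
  qed
qed

text \<open>Sums of magnitudes are maxima, which monotone maps preserve.\<close>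

lemma mul_mag_add:
  assumes "e f = f" "e g = g" shows "x \<odot> (f \<oplus> g) = x \<odot> f \<oplus> x \<odot> g"
proof (cases "f \<preceq> g")
  case True
  then show ?thesis using assms mul_mag_mono[of f g x] mag_le_iff mag_mul_mag' by metis
next
  case False
  with le_total have "g \<preceq> f" by blast
  then show ?thesis using assms mul_mag_mono[of g f x] mag_le_iff mag_mul_mag' add_comm by metis
qed

lemma nontrivial: "\<exists>x. x \<noteq> e x"
proof -
  obtain x where "e x \<noteq> \<zero>" using mag_nontrivial by blast
  then have "\<zero> \<prec> e x" using zero_le_mag[of "e x"] by auto
  then show ?thesis using mag_dense[of \<zero> "e x"] by auto
qed

text \<open>If \<open>w\<close> were negative, \<open>ng w\<close> would be positive, and its
  square, again \<open>w\<close>, would be at least a magnitude.\<close>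

lemma idempotent_pos:
  assumes "w \<odot> w = w" "e w \<noteq> w" shows "e w \<prec> w"
proof (rule ccontr)
  assume "\<not> ?thesis"
  with assms le_total have "w \<preceq> e w" by metis
  then have "e (ng w) \<preceq> ng w" using mag_le_neg_if_le_mag by simp
  moreover have "e (ng w) \<noteq> ng w" using assms(2) by (metis mag_neg neg_mag neg_neg)
  ultimately have "ng w \<odot> e (ng w) \<preceq> ng w \<odot> ng w" by (intro mul_left_mono) auto
  also have "ng w \<odot> ng w = w" by (simp add: assms neg_mul[symmetric] mul_neg)
  finally have "ng w \<odot> e (ng w) \<preceq> w" .
  moreover have "\<zero> \<preceq> ng w \<odot> e (ng w)" by (rule zero_le_mag) (simp add: mag_mul_mag')
  ultimately have "\<zero> \<preceq> w" using le_trans by blast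
  then have "e w \<preceq> w" by (simp add: pos_iff)
  then show False using \<open>w \<preceq> e w\<close> assms le_antisym by blast
qed

lemma one_pos: "e \<one> \<prec> \<one>"
proof (rule idempotent_pos)
  \<comment> \<open>Otherwise every \<open>x\<close>, as its own product with one, would be a
    magnitude.\<close>
  show "e \<one> \<noteq> \<one>" using nontrivial mag_mul_mag[of \<one>] by force
qed simp

lemma precise_part_pos:
  assumes "x = a \<oplus> e x" "e x \<prec> x" shows "e x \<prec> a"
proof (rule ccontr)
  assume "\<not> ?thesis"
  then have "a \<preceq> e x" using le_total[of a "e x"] by auto
  then have "x \<preceq> e x" using assms(1) add_right_mono[of a "e x" "e x"] by simp
  then show False using assms le_antisym by blast
qed

text \<open>Bounds a positive zeroless element by a precise one, at the cost of a factor
  two.\<close>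

lemma le_precise_double:
  assumes "e x \<prec> x" obtains c where "e c = \<zero>" "x = c \<oplus> e x" "e x \<prec> c" "x \<preceq> c \<oplus> c"
  using precise_decomp[of x] precise_part_pos assms add_left_mono by metis

lemma mag_one_mul_le: "e \<one> \<odot> x \<preceq> e x"
proof -
  have "e x = e \<one> \<odot> x \<oplus> e x" using mag_mul[of \<one> x] by simp
  then show ?thesis by (metis mag_le_addI(1) mag_mul_mag mag_mag)
qed

text \<open>Since \<^term>\<open>\<one>\<close> lies below twice its precise part, multiplying by \<^term>\<open>e \<one>\<close> gives \<^term>\<open>\<zero>\<close>.\<close>

lemma mag_one [simp]: "e \<one> = \<zero>"
proof -
  obtain a where a: "e a = \<zero>" "\<one> \<preceq> a \<oplus> a" using le_precise_double[OF one_pos] by metis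
  have "e \<one> \<odot> \<one> \<preceq> e \<one> \<odot> (a \<oplus> a)" using a one_pos pos_iff by (intro mag_mul_left_mono) auto
  also have "\<dots> \<preceq> e (a \<oplus> a)" by (rule mag_one_mul_le)
  also have "\<dots> = \<zero>" by (simp add: mag_add a)
  finally show ?thesis using zero_le_mag[of "e \<one>"] le_antisym by simp
qed

lemma zero_lt_one: "\<zero> \<prec> \<one>"
  using one_pos by simp

section \<open>Units and inverses\<close>

lemma is_unit_of_unit: "x \<noteq> e x \<Longrightarrow> is_unit_of mul x (u x)"
  unfolding unt_def by (rule theI') (rule unit_ex1)

lemma mul_unit: "x \<noteq> e x \<Longrightarrow> x \<odot> u x = x"
  using is_unit_of_unit by (simp add: is_unit_of_def)

lemma unit_idem: "x \<noteq> e x \<Longrightarrow> u x \<odot> u x = u x"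
  using is_unit_of_unit by (simp add: is_unit_of_def)

lemma mul_inv: "x \<noteq> e x \<Longrightarrow> x \<odot> iv x = u x"
  and unit_inv: "x \<noteq> e x \<Longrightarrow> u (iv x) = u x"
  using theI'[OF inv_ex1[of x]] by (simp_all add: Defs.inv_def)

lemma unit_zeroless: "x \<noteq> e x \<Longrightarrow> u x \<noteq> e (u x)"
  by (metis mul_unit mag_mul_mag')

lemma unit_pos: "x \<noteq> e x \<Longrightarrow> e (u x) \<prec> u x"
  using idempotent_pos unit_idem unit_zeroless by metis

lemma inv_zeroless: "x \<noteq> e x \<Longrightarrow> iv x \<noteq> e (iv x)"
  by (metis mul_inv mag_mul_mag' unit_zeroless)

text \<open>AM2 applied to \<open>x\<close> times \<open>u x\<close> gives two summands, and AM3
  shows that they coincide.\<close>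

lemma mag_mul_own_unit:
  assumes "x \<noteq> e x" shows "e x \<odot> u x = e x"
proof -
  have "e x = e x \<odot> u x \<oplus> e (u x) \<odot> x" using mag_mul[of x "u x"] mul_unit assms by simp
  also have "e (u x) \<odot> x = e x \<odot> u x"
    unfolding mag_unit[OF assms] unfolding mul_inv[OF assms, symmetric] by (simp only: mul_ac)
  finally show ?thesis by (metis mag_add_self mag_mul_mag mag_mag)
qed

text \<open>Otherwise multiplying \<open>ng (iv x)\<close> by \<open>x\<close> would make
  \<open>ng (u x)\<close> nonnegative, although units are positive.\<close>

lemma inv_pos:
  assumes "e x \<prec> x" shows "e (iv x) \<prec> iv x"
proof (rule ccontr)
  have z: "x \<noteq> e x" using assms by metis
  assume "\<not> ?thesis"
  then have "iv x \<preceq> e (iv x)" using le_total[of "iv x" "e (iv x)"] by auto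
  then have "e (iv x) \<preceq> ng (iv x)" by (rule mag_le_neg_if_le_mag)
  then have "x \<odot> e (iv x) \<preceq> x \<odot> ng (iv x)" by (intro mul_left_mono assms)
  also have "\<dots> = ng (u x)" by (simp add: mul_neg mul_inv z)
  finally have "\<zero> \<preceq> ng (u x)"
    using nonneg_if_mag_le[of "x \<odot> e (iv x)"] by (simp add: mag_mul_mag')
  then have "e (ng (u x)) \<preceq> ng (u x)" using pos_iff[of "ng (u x)"] by simp
  then have "u x \<preceq> e (u x)" using neg_le_mag_if_mag_le by fastforce
  then show False using unit_pos[OF z] le_antisym by blast
qed

section \<open>Precise elements: products with zero, inverses, density\<close>

lemma zero_mul_small:
  assumes "\<zero> \<preceq> y" "y \<preceq> \<one>" shows "\<zero> \<odot> y = \<zero>"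
  using assms mag_mul_left_mono[of \<zero> y \<one>] zero_le_mag[of "\<zero> \<odot> y"] le_antisym
  by (simp add: mag_mul_mag)

lemma zero_mul_zero: "\<zero> \<odot> \<zero> = \<zero>"
  using zero_mul_small zero_lt_one by simp

text \<open>Monotonicity settles \<open>p\<close> up to one. For larger \<open>p\<close>, either
  \<open>iv p\<close> is at most one and the product is rewritten through zero times
  \<open>u p\<close>, or \<open>iv p\<close> is at least one too, which forces
  \<open>u p = p\<close>.\<close>

lemma zero_mul_pos_precise:
  assumes p: "e p = \<zero>" "\<zero> \<prec> p" shows "\<zero> \<odot> p = \<zero>"
proof (cases "p \<preceq> \<one>")
  case True
  then show ?thesis using zero_mul_small assms by simp
next
  case False
  then have p1: "\<one> \<preceq> p" using le_total by blast
  have z: "p \<noteq> e p" using p by auto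
  have mu: "e (u p) = \<zero> \<odot> iv p" using mag_unit z p by simp
  have zu: "\<zero> \<odot> u p = \<zero>" if "e (u p) = \<zero>"
    using mag_mul[of "u p" "u p"] unit_idem[OF z] that by (metis mag_add_self mag_mul_mag mag_zero)
  show ?thesis
  proof (cases "iv p \<preceq> \<one>")
    case True
    have "\<zero> \<preceq> iv p" using inv_pos[of p] p pos_iff by auto
    then have i: "\<zero> \<odot> iv p = \<zero>" using zero_mul_small True by simp
    have "\<zero> \<odot> p = p \<odot> (\<zero> \<odot> iv p)" by (simp add: i mul_comm)
    also have "\<dots> = \<zero> \<odot> u p"
      unfolding mul_inv[OF z, symmetric] by (simp only: mul_ac)
    finally show ?thesis using zu mu i by simp
  next
    case False
    then have "\<one> \<preceq> iv p" using le_total by blast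
    then have "p \<odot> \<one> \<preceq> p \<odot> iv p" using p by (intro mul_left_mono) auto
    then have "p \<preceq> u p" by (simp add: mul_inv z)
    moreover have "u p \<odot> \<one> \<preceq> u p \<odot> p" by (intro mul_left_mono unit_pos z p1)
    then have "u p \<preceq> p" using mul_unit[OF z] by (simp add: mul_comm)
    ultimately have "u p = p" by (intro le_antisym)
    then show ?thesis using zu p by simp
  qed
qed

lemma neg_precise_nonneg:
  assumes "e p = \<zero>" "p \<preceq> \<zero>" shows "\<zero> \<preceq> ng p"
  using mag_le_neg_if_le_mag[of p] assms by simp

text \<open>This fails for general elements: the axioms allow the product of \<^term>\<open>\<zero>\<close> and the largest magnitude
  to be the largest magnitude.\<close>

lemma zero_mul_precise:
  assumes "e p = \<zero>" shows "\<zero> \<odot> p = \<zero>"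
proof (cases "\<zero> \<preceq> p")
  case True
  then show ?thesis using zero_mul_pos_precise assms zero_mul_zero by (cases "p = \<zero>") auto
next
  case False
  then have "\<zero> \<preceq> ng p" using neg_precise_nonneg[OF assms] le_total by blast
  then have "\<zero> \<odot> ng p = \<zero>"
    using zero_mul_pos_precise[of "ng p"] assms zero_mul_zero by (cases "ng p = \<zero>") auto
  then show ?thesis by (simp add: mag_mul_neg)
qed

lemma precise_mul: "e p = \<zero> \<Longrightarrow> e q = \<zero> \<Longrightarrow> e (p \<odot> q) = \<zero>"
  by (simp add: mag_mul zero_mul_precise)

lemma precise_add: "e p = \<zero> \<Longrightarrow> e q = \<zero> \<Longrightarrow> e (p \<oplus> q) = \<zero>"
  by (simp add: mag_add)

text \<open>Needed for \<open>iv p\<close>, which is known to be positive before it is known to be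
  precise.\<close>

lemma zero_mul_pos:
  assumes "e y \<prec> y" shows "\<zero> \<odot> y = \<zero>"
proof -
  obtain c where c: "e c = \<zero>" "y \<preceq> c \<oplus> c" using le_precise_double[OF assms] by metis
  have "\<zero> \<odot> y \<preceq> \<zero> \<odot> (c \<oplus> c)" using assms pos_iff c by (intro mag_mul_left_mono) auto
  also have "\<dots> = \<zero>" by (simp add: zero_mul_precise precise_add c)
  finally show ?thesis using zero_le_mag[of "\<zero> \<odot> y"] mag_mul_mag le_antisym by simp
qed

text \<open>By AM2, \<open>e (iv p)\<close> times \<open>p\<close> is a summand of
  \<open>e (u p)\<close>, which is zero; multiplying back by \<open>iv p\<close> recovers
  \<open>e (iv p)\<close>.\<close>

lemma precise_inv:
  assumes p: "e p = \<zero>" "\<zero> \<prec> p" shows "e (iv p) = \<zero>"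
proof -
  have z: "p \<noteq> e p" using p by auto
  have i0: "\<zero> \<odot> iv p = \<zero>" using inv_pos[of p] p by (intro zero_mul_pos) auto
  have "e (u p) = \<zero> \<odot> iv p \<oplus> e (iv p) \<odot> p" using mag_mul[of p "iv p"] mul_inv[OF z] p by simp
  then have ip: "e (iv p) \<odot> p = \<zero>" using mag_unit[OF z] i0 p by simp
  have "e (iv p) = e (iv p) \<odot> u (iv p)" using mag_mul_own_unit inv_zeroless[OF z] by simp
  also have "\<dots> = (e (iv p) \<odot> p) \<odot> iv p" using mul_inv[OF z] unit_inv[OF z] by (simp add: mul_assoc)
  finally show ?thesis using ip i0 by simp
qed

text \<open>E6 gives a zeroless \<open>z\<close>, and \<open>b\<close> is its precise part. If
  \<open>b\<close> were at most \<open>f\<close>, then \<open>z\<close> would be at most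
  \<open>f\<close> or \<open>e z\<close>.\<close>

lemma precise_dense:
  assumes "e f = f" "e g = g" "f \<prec> g" obtains b where "e b = \<zero>" "f \<prec> b" "b \<preceq> g"
proof -
  obtain z where z: "z \<noteq> e z" "f \<prec> z" "z \<prec> g" using mag_dense[of f g] assms by auto
  obtain b where b: "z = b \<oplus> e z" "e b = \<zero>" using precise_decomp by blast
  have zp: "e z \<preceq> z" using z assms nonneg_if_mag_le[of f z] pos_iff by simp
  have "b \<preceq> z" using add_left_mono[OF zero_le_mag[of "e z"], of b] b by simp
  moreover have "\<not> b \<preceq> f"
  proof
    assume bf: "b \<preceq> f"
    then have "z \<preceq> f \<oplus> e z" using add_right_mono[OF bf, of "e z"] b by simp
    then show False using mag_sum_cases[of f "e z"] zp z assms
      le_antisym[of z f] le_antisym[of z "e z"] by auto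
  qed
  moreover from this have "f \<prec> b" using le_total[of f b] by auto
  ultimately show ?thesis using that[of b] b z le_trans[of b z g] by simp
qed

end

section \<open>Consequences of distributivity among precise elements, which either condition
  supplies\<close>

locale precise_distributive_solid = predistributive_solid +
  assumes precise_distrib: "\<lbrakk>e x = \<zero>; e y = \<zero>; e z = \<zero>\<rbrakk> \<Longrightarrow> x \<odot> (y \<oplus> z) = x \<odot> y \<oplus> x \<odot> z"
begin

lemma precise_mul_inv:
  assumes p: "e p = \<zero>" "\<zero> \<prec> p" shows "p \<odot> iv p = \<one>"
proof -
  have z: "p \<noteq> e p" using p by auto
  define w where "w = p \<odot> iv p"
  have wu: "w = u p" unfolding w_def by (rule mul_inv[OF z])
  have "e w = \<zero>" unfolding w_def by (intro precise_mul precise_inv p)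
  then have w: "e w = \<zero>" "w \<odot> w = w" "\<zero> \<prec> w"
    using unit_idem[OF z] unit_pos[OF z] wu by simp_all
  \<comment> \<open>The idempotents \<^term>\<open>w\<close> and \<open>\<one> - w\<close> have product zero, and nonzero idempotents are positive.\<close>
  define v where "v = \<one> \<oplus> ng w"
  have v: "e v = \<zero>" unfolding v_def by (simp add: mag_add w)
  have vw: "w \<oplus> v = \<one>" using w unfolding v_def by (simp add: add_left_comm[of w])
  have wv: "w \<odot> v = \<zero>"
    unfolding v_def using precise_distrib[of w \<one> "ng w"] w by (simp add: mul_neg)
  have "v = v \<odot> w \<oplus> v \<odot> v" using precise_distrib[of v w v] w v vw by simp
  then have vv: "v \<odot> v = v" using wv by (simp add: mul_comm)
  have "v = \<zero>"
  proof (rule ccontr)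
    assume "v \<noteq> \<zero>"
    then have v0: "\<zero> \<prec> v" using idempotent_pos[OF vv] v by auto
    show False
    \<comment> \<open>The smaller of \<open>w\<close> and \<open>v\<close> equals its own square,
      which is at most their product, zero.\<close>
    proof (cases "w \<preceq> v")
      case True
      then have "w \<odot> w \<preceq> w \<odot> v" using w by (intro mul_left_mono) auto
      then show False using w wv le_antisym by auto
    next
      case False
      then have "v \<preceq> w" using le_total by blast
      then have "v \<odot> v \<preceq> v \<odot> w" using v v0 by (intro mul_left_mono) auto
      then show False using vv v0 wv le_antisym by (auto simp: mul_comm)
    qed
  qed
  then show ?thesis using vw w_def by simp
qed

lemma double_eq: "e c = \<zero> \<Longrightarrow> c \<odot> (\<one> \<oplus> \<one>) = c \<oplus> c"
  using precise_distrib[of c \<one> \<one>] by simp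

lemma two_pos: "\<zero> \<prec> \<one> \<oplus> \<one>" "\<one> \<preceq> \<one> \<oplus> \<one>"
proof -
  show "\<one> \<preceq> \<one> \<oplus> \<one>" using add_left_mono[of \<zero> \<one> \<one>] zero_lt_one by simp
  then show "\<zero> \<prec> \<one> \<oplus> \<one>"
    using zero_lt_one le_trans[of \<zero> \<one> "\<one> \<oplus> \<one>"] le_antisym[of \<zero> \<one>] by auto
qed

lemma mag_mul_two:
  assumes E: "e f = f" shows "f \<odot> (\<one> \<oplus> \<one>) = f"
proof (rule ccontr)
  let ?t = "\<one> \<oplus> \<one>" and ?h = "iv (\<one> \<oplus> \<one>)"
  assume n: "f \<odot> ?t \<noteq> f"
  have "f \<odot> \<one> \<preceq> f \<odot> ?t" using two_pos zero_lt_one E by (intro mag_mul_left_mono) auto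
  with n have "f \<prec> f \<odot> ?t" by auto
  then obtain b where b: "e b = \<zero>" "f \<prec> b" "b \<preceq> f \<odot> ?t"
    using precise_dense[OF E mag_mul_mag[OF E]] by metis
  have t: "e ?t = \<zero>" by (simp add: precise_add)
  have th: "?t \<odot> ?h = \<one>" using precise_mul_inv t two_pos by simp
  have h: "e ?h = \<zero>" "\<zero> \<prec> ?h" using precise_inv[OF t] inv_pos[of ?t] two_pos t by auto
  \<comment> \<open>Half of \<open>b\<close> is at most \<open>f\<close>, so \<open>b\<close>, the
    sum of two halves, is at most \<open>f\<close> as well.\<close>
  have "?h \<odot> b \<preceq> ?h \<odot> (f \<odot> ?t)" using h b by (intro mul_left_mono) auto
  also have "\<dots> = f \<odot> (?t \<odot> ?h)" by (simp only: mul_ac)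
  also have "\<dots> = f" using th by simp
  finally have "?h \<odot> b \<oplus> ?h \<odot> b \<preceq> f \<oplus> f" using add_mono by blast
  also have "\<dots> = f" using E by (metis mag_add_self)
  also have "?h \<odot> b \<oplus> ?h \<odot> b = (?h \<odot> b) \<odot> ?t" using double_eq precise_mul h b by simp
  also have "\<dots> = b \<odot> (?t \<odot> ?h)" by (simp only: mul_ac)
  also have "\<dots> = b" using th by simp
  finally show False using b le_antisym by blast
qed

text \<open>If \<open>c\<close> is at most \<open>g\<close>, it is absorbed; otherwise the sum is at
  most twice \<open>c\<close>, and \<open>f\<close> swallows the factor two.\<close>

lemma mag_mul_decomp_pos:
  assumes "e f = f" "e g = g" "e c = \<zero>" "\<zero> \<preceq> c"
  shows "f \<odot> (c \<oplus> g) = f \<odot> c \<oplus> f \<odot> g"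
proof (cases "c \<preceq> g")
  case True
  then show ?thesis using assms absorbed_if_le[of g c] mag_mul_left_mono[of f c g]
    by (simp add: mag_le_iff mag_mul_mag)
next
  case False
  then have gc: "g \<preceq> c" using le_total by blast
  have "f \<odot> (c \<oplus> g) \<preceq> f \<odot> (c \<oplus> c)"
    using assms zero_le_mag add_left_mono[OF gc, of c] add_mono[of \<zero> c \<zero> g] by (intro mag_mul_left_mono) auto
  also have "\<dots> = f \<odot> (\<one> \<oplus> \<one>) \<odot> c"
    unfolding double_eq[OF assms(3), symmetric] by (simp only: mul_ac)
  also have "\<dots> = f \<odot> c" using mag_mul_two assms by simp
  finally have "f \<odot> (c \<oplus> g) \<preceq> f \<odot> c" .
  moreover have "f \<odot> c \<preceq> f \<odot> (c \<oplus> g)"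
    using assms zero_le_mag add_left_mono[of \<zero> g c] by (intro mag_mul_left_mono) auto
  moreover have "f \<odot> c \<oplus> f \<odot> g = f \<odot> c"
    using mag_mul_left_mono[OF _ _ gc, of f] assms zero_le_mag
    by (simp add: add_mag_absorb mag_mul_mag)
  ultimately show ?thesis using le_antisym by simp
qed

lemma mag_mul_decomp:
  assumes "e f = f" "e g = g" "e c = \<zero>"
  shows "f \<odot> (c \<oplus> g) = f \<odot> c \<oplus> f \<odot> g"
proof (cases "\<zero> \<preceq> c")
  case False
  then have "\<zero> \<preceq> ng c" using neg_precise_nonneg assms le_total by blast
  then have "f \<odot> (ng c \<oplus> g) = f \<odot> ng c \<oplus> f \<odot> g" using assms by (intro mag_mul_decomp_pos) auto
  moreover have "ng c \<oplus> g = ng (c \<oplus> g)" using assms neg_mag[of g] by (simp add: neg_add)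
  ultimately show ?thesis using assms by (simp add: mag_mul_neg)
qed (use assms mag_mul_decomp_pos in auto)

lemma mag_mul_le_if_abs_le_double:
  assumes "e f = f" "e p = \<zero>" "e m = \<zero>" "p \<preceq> m \<oplus> m" "ng p \<preceq> m \<oplus> m"
  shows "f \<odot> p \<preceq> f \<odot> m"
proof -
  have "f \<odot> p \<preceq> f \<odot> (m \<oplus> m)"
  proof (cases "\<zero> \<preceq> p")
    case True
    then show ?thesis using assms by (intro mag_mul_left_mono) auto
  next
    case False
    then have "\<zero> \<preceq> ng p" using neg_precise_nonneg assms le_total by blast
    then have "f \<odot> ng p \<preceq> f \<odot> (m \<oplus> m)" using assms by (intro mag_mul_left_mono) auto
    then show ?thesis using assms by (simp add: mag_mul_neg)
  qed
  also have "\<dots> = f \<odot> (\<one> \<oplus> \<one>) \<odot> m"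
    unfolding double_eq[OF assms(3), symmetric] by (simp only: mul_ac)
  also have "\<dots> = f \<odot> m" using mag_mul_two assms by simp
  finally show ?thesis .
qed

text \<open>The witness \<open>m\<close> is the absolute value of \<open>a\<close>, which magnitudes
  cannot tell from \<open>a\<close>.\<close>

lemma precise_abs:
  assumes "e a = \<zero>"
  obtains m where "e m = \<zero>" "a \<preceq> m" "ng a \<preceq> m" "\<And>f. e f = f \<Longrightarrow> f \<odot> m = f \<odot> a"
proof (cases "\<zero> \<preceq> a")
  case True
  then have "ng a \<preceq> a" using neg_le_mag_if_mag_le[of a] assms le_trans[of "ng a" \<zero> a] by simp
  then show ?thesis using that[of a] assms by simp
next
  case False
  then have "a \<preceq> \<zero>" using le_total by blast
  then have "a \<preceq> ng a" using neg_precise_nonneg[OF assms] le_trans[of a \<zero> "ng a"] by simp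
  then show ?thesis using that[of "ng a"] assms by (simp add: mag_mul_neg)
qed

text \<open>The absolute value of the sum is at most twice the larger of the two absolute values,
  and \<open>f\<close> swallows the factor two.\<close>

lemma mag_mul_precise_add_le:
  assumes f: "e f = f" and b: "e b = \<zero>" and c: "e c = \<zero>"
  shows "f \<odot> (b \<oplus> c) \<preceq> f \<odot> b \<oplus> f \<odot> c"
proof -
  obtain m where m: "e m = \<zero>" "b \<preceq> m" "ng b \<preceq> m" "f \<odot> m = f \<odot> b"
    using precise_abs[OF b] f by metis
  obtain n where n: "e n = \<zero>" "c \<preceq> n" "ng c \<preceq> n" "f \<odot> n = f \<odot> c"
    using precise_abs[OF c] f by metis
  have bd: "f \<odot> (b \<oplus> c) \<preceq> f \<odot> k"
    if "e k = \<zero>" "b \<preceq> k" "ng b \<preceq> k" "c \<preceq> k" "ng c \<preceq> k" for k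
    using that f b c by (intro mag_mul_le_if_abs_le_double) (auto simp: precise_add neg_add add_mono)
  have "f \<odot> (b \<oplus> c) \<preceq> f \<odot> b \<or> f \<odot> (b \<oplus> c) \<preceq> f \<odot> c"

  proof (cases "m \<preceq> n")
    case True
    then show ?thesis using bd[of n] m n le_trans[of _ m n] by simp
  next
    case False
    then have "n \<preceq> m" using le_total by blast
    then show ?thesis using bd[of m] m n le_trans[of _ n m] by simp
  qed
  then show ?thesis using f by (simp add: le_mag_add_iff mag_mul_mag)
qed

lemma mag_mul_add_mag:
  assumes "e f = f" "e g = g" shows "f \<odot> (x \<oplus> g) = f \<odot> x \<oplus> f \<odot> g"
proof -
  obtain c where c: "x = c \<oplus> e x" "e c = \<zero>" using precise_decomp by blast
  have "f \<odot> (x \<oplus> g) = f \<odot> (c \<oplus> (e x \<oplus> g))" using c by (metis add_assoc)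
  also have "\<dots> = f \<odot> c \<oplus> f \<odot> (e x \<oplus> g)" using assms c by (intro mag_mul_decomp) (auto simp: mag_add)
  also have "\<dots> = f \<odot> c \<oplus> f \<odot> e x \<oplus> f \<odot> g"
    using assms mul_mag_add[of "e x" g f] by (simp add: add_assoc)
  also have "f \<odot> c \<oplus> f \<odot> e x = f \<odot> x"
    using mag_mul_decomp[of f "e x" c] assms c by simp
  finally show ?thesis .
qed

text \<open>Subdistributivity: the precise parts satisfy it, and magnitude summands distribute
  exactly.\<close>

lemma mag_mul_add_le:
  assumes f: "e f = f" shows "f \<odot> (x \<oplus> y) \<preceq> f \<odot> x \<oplus> f \<odot> y"
proof -
  obtain b where b: "x = b \<oplus> e x" "e b = \<zero>" using precise_decomp by blast
  obtain c where c: "y = c \<oplus> e y" "e c = \<zero>" using precise_decomp by blast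
  have "x \<oplus> y = b \<oplus> c \<oplus> (e x \<oplus> e y)" by (subst b(1), subst c(1)) (simp only: add_ac)
  then have "f \<odot> (x \<oplus> y) = f \<odot> (b \<oplus> c) \<oplus> f \<odot> (e x \<oplus> e y)"
    using f by (simp add: mag_mul_add_mag mag_add)
  also have "\<dots> \<preceq> f \<odot> b \<oplus> f \<odot> c \<oplus> f \<odot> (e x \<oplus> e y)"
    by (intro add_right_mono mag_mul_precise_add_le f b c)
  also have "\<dots> = (f \<odot> b \<oplus> f \<odot> e x) \<oplus> (f \<odot> c \<oplus> f \<odot> e y)"
    unfolding mul_mag_add[OF mag_mag mag_mag] by (simp only: add_ac)
  also have "f \<odot> b \<oplus> f \<odot> e x = f \<odot> x" using mag_mul_decomp[of f "e x" b] f b by simp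
  also have "f \<odot> c \<oplus> f \<odot> e y = f \<odot> y" using mag_mul_decomp[of f "e y" c] f c by simp
  finally show ?thesis .
qed

lemma mag_mul_mag_le:
  assumes f: "e f = f" shows "f \<odot> e x \<preceq> f \<odot> x"
proof -
  obtain c where c: "x = c \<oplus> e x" "e c = \<zero>" using precise_decomp by blast
  then have "f \<odot> x = f \<odot> c \<oplus> f \<odot> e x" using f by (metis mag_mul_add_mag mag_mag)
  then show ?thesis using f by (simp add: mag_le_addI mag_mul_mag)
qed

lemma mag_mul_unit:
  assumes f: "e f = f" and z: "x \<noteq> e x" shows "f \<odot> u x = f"
proof -
  obtain c where c: "e c = \<zero>" "u x = c \<oplus> e (u x)" "e (u x) \<prec> c"
    using le_precise_double[OF unit_pos[OF z]] by metis
  have c0: "\<zero> \<prec> c" using c pos_if_mag_less[of "e (u x)" c] by simp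
  have fu: "g \<odot> u x = g \<odot> c" if g: "e g = g" for g
  proof -
    have "g \<odot> e (u x) \<preceq> g \<odot> c" using g c zero_le_mag by (intro mag_mul_left_mono) auto
    then have "g \<odot> c \<oplus> g \<odot> e (u x) = g \<odot> c"
      using g by (simp add: add_mag_absorb mag_mul_mag)
    then show ?thesis using g c(2) mag_mul_add_mag[of g "e (u x)" c] by simp
  qed
  \<comment> \<open>Idempotence of \<^term>\<open>u x\<close> makes multiplication by \<^term>\<open>c\<close> idempotent on magnitudes, and \<^term>\<open>c\<close> cancels.\<close>
  have "f \<odot> c = f \<odot> (u x \<odot> u x)" using fu[OF f] unit_idem[OF z] by simp
  also have "\<dots> = (f \<odot> u x) \<odot> u x" by (simp only: mul_assoc)
  also have "\<dots> = f \<odot> c \<odot> c" using fu[OF f] fu[of "f \<odot> c"] f mag_mul_mag by simp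
  finally have "f \<odot> c \<odot> iv c = f \<odot> c \<odot> c \<odot> iv c" by simp
  then have "f = f \<odot> c" using precise_mul_inv[OF c(1) c0] by (simp add: mul_assoc)
  then show ?thesis using fu f by simp
qed

section \<open>The largest magnitude and relative uncertainties\<close>

lemma le_mag_bigM: "x \<preceq> e (bigM add)"
proof -
  let ?E = "e (bigM add)"
  have "\<forall>x. e x \<oplus> bigM add = bigM add" unfolding bigM_def by (rule someI_ex) (rule bigM_ex)
  then have ex: "e x \<preceq> ?E" for x
    using mag_absorbs[of "bigM add" "e x"] by (simp add: mag_le_iff add_comm)
  obtain y where "e y \<noteq> \<zero>" using mag_nontrivial by blast
  then have "\<zero> \<prec> ?E"
    using ex[of y] zero_le_mag[of "e y"] pos_if_mag_less[of "e y" ?E] by (cases "e y = ?E") auto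
  \<comment> \<open>Dividing by \<open>b\<close> puts one below \<open>?E\<close>; multiplying by a
    positive precise \<open>p\<close> then puts \<open>p\<close> below \<open>?E\<close>.\<close>
  then obtain b where b: "e b = \<zero>" "\<zero> \<prec> b" "b \<preceq> ?E" using precise_dense[of \<zero> ?E] by auto
  obtain p where p: "x = p \<oplus> e x" "e p = \<zero>" using precise_decomp by blast
  have "p \<preceq> ?E"
  proof (cases "\<zero> \<prec> p")
    case True
    have "e (iv b) = \<zero>" "e (iv b) \<prec> iv b" using b precise_inv[of b] inv_pos[of b] by auto
    then have "iv b \<odot> b \<preceq> iv b \<odot> ?E" using b by (intro mul_left_mono) auto
    then have "\<one> \<preceq> iv b \<odot> ?E" using precise_mul_inv b by (simp add: mul_comm)
    also have "\<dots> \<preceq> ?E" using ex[of "iv b \<odot> ?E"] by (simp add: mag_mul_mag')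
    finally have "p \<odot> \<one> \<preceq> p \<odot> ?E" using True p by (intro mul_left_mono) auto
    also have "\<dots> \<preceq> ?E" using ex[of "p \<odot> ?E"] by (simp add: mag_mul_mag')
    finally show ?thesis by simp
  next
    case False
    then show ?thesis
      using le_total[of \<zero> p] zero_le_mag[of ?E] le_trans[of p \<zero> ?E] by auto
  qed
  then have "p \<oplus> e x \<preceq> ?E \<oplus> ?E" using add_mono ex by blast
  then show ?thesis using p by simp
qed

text \<open>\<open>bigM\<close> is only chosen to absorb all magnitudes; it is one itself because
  \<open>?E\<close>, with \<open>?E\<close> its magnitude, also bounds its negative.\<close>

lemma mag_bigM: "e (bigM add) = bigM add"
proof -
  have "e (bigM add) \<preceq> bigM add"
    using mag_le_neg_if_le_mag[of "ng (bigM add)"] le_mag_bigM[of "ng (bigM add)"] by simp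
  then show ?thesis using le_mag_bigM le_antisym by blast
qed

abbreviation R :: "'a \<Rightarrow> 'a" where "R \<equiv> relunc add mul"

lemma relunc_mag: "x = e x \<Longrightarrow> R x = bigM add"
  by (simp add: relunc_def)

lemma mag_relunc: "e (R x) = R x"
  by (simp add: relunc_def mag_bigM)

lemma relunc_zeroless: "x \<noteq> e x \<Longrightarrow> R x = e x \<odot> iv x"
  by (simp add: relunc_def mag_unit)

text \<open>For zeroless \<open>x\<close> the positive \<open>u x\<close> lies below
  \<open>bigM\<close>, so its magnitude cannot reach \<open>bigM\<close>.\<close>

lemma bigM_le_relunc_iff: "bigM add \<preceq> R x \<longleftrightarrow> x = e x"
proof
  assume *: "bigM add \<preceq> R x"
  show "x = e x"
  proof (rule ccontr)
    assume z: "x \<noteq> e x"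
    then have "u x \<preceq> e (u x)"
      using * le_mag_bigM[of "u x"] le_trans[of "u x" "bigM add"] by (simp add: relunc_def mag_bigM)
    then show False using unit_pos[OF z] le_antisym by blast
  qed
qed (simp add: relunc_mag)

text \<open>Multiply by \<open>x\<close> and \<open>y\<close>, or by their inverses; the units that
  arise act trivially on magnitudes.\<close>

lemma relunc_le_iff:
  assumes x: "x \<noteq> e x" and y: "y \<noteq> e y"
  shows "R x \<preceq> R y \<longleftrightarrow> e x \<odot> y \<preceq> x \<odot> e y"
proof
  assume "R x \<preceq> R y"
  then have "(x \<odot> y) \<odot> R x \<preceq> (x \<odot> y) \<odot> R y" by (intro mul_mag_mono mag_relunc)
  moreover have "(x \<odot> y) \<odot> R x = (e x \<odot> u x) \<odot> y" "(x \<odot> y) \<odot> R y = x \<odot> (e y \<odot> u y)"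
    by (simp_all only: relunc_zeroless[OF x] relunc_zeroless[OF y]
        mul_inv[OF x, symmetric] mul_inv[OF y, symmetric] mul_ac)
  ultimately show "e x \<odot> y \<preceq> x \<odot> e y" by (simp add: mag_mul_unit x y)
next
  assume "e x \<odot> y \<preceq> x \<odot> e y"
  then have "(iv x \<odot> iv y) \<odot> (e x \<odot> y) \<preceq> (iv x \<odot> iv y) \<odot> (x \<odot> e y)"
    by (intro mul_mag_mono mag_mul_mag mag_mul_mag' mag_mag)
  moreover have "(iv x \<odot> iv y) \<odot> (e x \<odot> y) = R x \<odot> u y" "(iv x \<odot> iv y) \<odot> (x \<odot> e y) = R y \<odot> u x"
    by (simp_all only: relunc_zeroless[OF x] relunc_zeroless[OF y]
        mul_inv[OF x, symmetric] mul_inv[OF y, symmetric] mul_ac)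
  ultimately show "R x \<preceq> R y" by (simp add: mag_mul_unit mag_relunc x y)
qed

text \<open>Since \<open>y\<close> plus \<open>e z\<close> is the sum minus \<open>z\<close>,
  subdistributivity bounds \<open>f\<close> times \<open>y\<close> by \<open>f\<close> times the sum
  or by \<open>f\<close> times \<open>z\<close>, and the latter is too small.\<close>

lemma mag_mul_add_eq_if_less:
  assumes f: "e f = f" and lt: "\<not> f \<odot> y \<preceq> f \<odot> z"
  shows "f \<odot> (y \<oplus> z) = f \<odot> y \<oplus> f \<odot> z"
proof -
  have "f \<odot> y \<preceq> f \<odot> (y \<oplus> e z)"
    using f by (simp add: mag_mul_add_mag mag_le_addI mag_mul_mag)
  also have "y \<oplus> e z = (y \<oplus> z) \<oplus> ng z" by (simp add: add_assoc)
  also have "f \<odot> \<dots> \<preceq> f \<odot> (y \<oplus> z) \<oplus> f \<odot> z"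
    using mag_mul_add_le[OF f, of "y \<oplus> z" "ng z"] f by (simp add: mag_mul_neg)
  finally have "f \<odot> y \<preceq> f \<odot> (y \<oplus> z)" using lt f by (simp add: le_mag_add_iff mag_mul_mag)
  moreover from this have "f \<odot> z \<preceq> f \<odot> (y \<oplus> z)"
    using lt le_total[of "f \<odot> y" "f \<odot> z"] le_trans[of "f \<odot> z" "f \<odot> y"] by simp
  ultimately have "f \<odot> y \<oplus> f \<odot> z \<preceq> f \<odot> (y \<oplus> z)" using f by (simp add: mag_add_le_iff mag_mul_mag)
  then show ?thesis using mag_mul_add_le[OF f] le_antisym by blast
qed

text \<open>The right side says that the magnitude of the product of \<open>x\<close> with the sum
  absorbs the extra terms of the axiom.\<close>

lemma distrib_criterion_iff:
  "e x \<odot> (y \<oplus> z) = e x \<odot> y \<oplus> e x \<odot> z \<or> R x \<preceq> R y \<oplus> R z \<longleftrightarrow>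
   e x \<odot> y \<oplus> e x \<odot> z \<preceq> e x \<odot> (y \<oplus> z) \<oplus> (x \<odot> e y \<oplus> x \<odot> e z)"
proof (cases "e x \<odot> (y \<oplus> z) = e x \<odot> y \<oplus> e x \<odot> z")
  case True
  then show ?thesis by (simp add: mag_le_addI mag_mul_mag mag_mul_mag' mag_add)
next
  case False
  \<comment> \<open>A magnitude among the summands would distribute exactly.\<close>
  have y: "y \<noteq> e y" using False mag_mul_add_mag[of "e x" y z] by (metis add_comm mag_mag)
  have z: "z \<noteq> e z" using False mag_mul_add_mag[of "e x" z y] by (metis mag_mag)
  have same: "e x \<odot> y = e x \<odot> z"
    using False mag_mul_add_eq_if_less[of "e x" y z] mag_mul_add_eq_if_less[of "e x" z y]
    by (metis add_comm le_antisym mag_mag)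
  then have sum: "e x \<odot> y \<oplus> e x \<odot> z = e x \<odot> y" by (metis mag_mul_mag mag_mag mag_add_self)
  have nle: "\<not> e x \<odot> y \<preceq> e x \<odot> (y \<oplus> z)"
    using False mag_mul_add_le[of "e x" y z] sum le_antisym by auto
  show ?thesis
  proof (cases "x = e x")
    \<comment> \<open>Here both sides fail: \<open>R x\<close> is \<open>bigM\<close>, out of reach
      for zeroless \<open>y\<close> and \<open>z\<close>, and the terms in \<open>e y\<close> and
      \<open>e z\<close> add nothing to \<open>e x\<close> times the sum.\<close>
    case True
    have "\<not> R x \<preceq> R y \<oplus> R z"
      using bigM_le_relunc_iff[of y] bigM_le_relunc_iff[of z] True y z
      by (simp add: relunc_mag le_mag_add_iff mag_relunc)
    moreover have "x \<odot> e y \<oplus> x \<odot> e z \<preceq> e x \<odot> (y \<oplus> z)"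
      using mag_mul_mag_le[of "e x" "y \<oplus> z"] True mul_mag_add[of "e y" "e z" x] by (simp add: mag_add)
    ultimately show ?thesis
      using \<open>e x \<odot> (y \<oplus> z) \<noteq> _\<close> sum nle le_trans[of "e x \<odot> y" "x \<odot> e y \<oplus> x \<odot> e z"]
      by (auto simp: le_mag_add_iff[of "e x \<odot> (y \<oplus> z)" "x \<odot> e y \<oplus> x \<odot> e z"]
          mag_mul_mag mag_mul_mag' mag_add)
  next
    case False
    note x = this
    show ?thesis
      using \<open>e x \<odot> (y \<oplus> z) \<noteq> _\<close> nle relunc_le_iff[OF x y] relunc_le_iff[OF x z] same
      by (simp add: sum[unfolded same] le_mag_add_iff mag_relunc mag_mul_mag mag_mul_mag' mag_add)
  qed
qed

end

section \<open>The two implications\<close>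

context predistributive_solid
begin

lemma distributivity_if_criterion:
  assumes crit: "\<And>x y z. x \<odot> y \<oplus> x \<odot> z = x \<odot> (y \<oplus> z) \<longleftrightarrow>
      (e x \<odot> (y \<oplus> z) = e x \<odot> y \<oplus> e x \<odot> z \<or>
       relunc add mul x \<preceq> relunc add mul y \<oplus> relunc add mul z)"
  shows "x \<odot> y \<oplus> x \<odot> z = x \<odot> (y \<oplus> z) \<oplus> e x \<odot> y \<oplus> e x \<odot> z"
proof -
  interpret precise_distributive_solid
  proof unfold_locales
    fix x y z assume "e x = \<zero>" "e y = \<zero>" "e z = \<zero>"
    then show "x \<odot> (y \<oplus> z) = x \<odot> y \<oplus> x \<odot> z"
      using crit[of x y z] by (simp add: zero_mul_precise precise_add)
  qed
  obtain a where a: "x = a \<oplus> e x" "e a = \<zero>" using precise_decomp by blast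
  \<comment> \<open>This is the first alternative of the criterion for the precise \<open>a\<close>.
    Precise parts vanish under zero, so only magnitudes remain.\<close>
  have zd: "\<zero> \<odot> (v \<oplus> w) = \<zero> \<odot> v \<oplus> \<zero> \<odot> w" for v w
  proof -
    have zm: "\<zero> \<odot> t = \<zero> \<odot> e t" for t
    proof -
      obtain b where "t = b \<oplus> e t" "e b = \<zero>" using precise_decomp by blast
      then show ?thesis using mag_mul_add_mag[of \<zero> "e t" b] by (simp add: zero_mul_precise)
    qed
    show ?thesis using zm[of "v \<oplus> w"] zm[of v] zm[of w] mul_mag_add[of "e v" "e w" \<zero>]
      by (simp add: mag_add)
  qed
  have ad: "a \<odot> (v \<oplus> w) = a \<odot> v \<oplus> a \<odot> w" for v w
    using crit[of a v w] a(2) zd[of v w] by simp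
  have xd: "x \<odot> w = a \<odot> w \<oplus> e x \<odot> w" for w
  proof -
    \<comment> \<open>The criterion is used with \<open>w\<close> as the outer factor; its first
      alternative holds because \<open>e x\<close> is a magnitude.\<close>
    have "w \<odot> a \<oplus> w \<odot> e x = w \<odot> (a \<oplus> e x)"
      using crit[of w a "e x"] mag_mul_add_mag[of "e w" "e x" a] by simp
    then show ?thesis using a by (simp add: mul_comm)
  qed
  have le: "e x \<odot> (y \<oplus> z) \<oplus> (e x \<odot> y \<oplus> e x \<odot> z) = e x \<odot> y \<oplus> e x \<odot> z"
    using mag_mul_add_le[of "e x" y z] mag_le_iff by (simp add: mag_mul_mag mag_add)
  have "x \<odot> y \<oplus> x \<odot> z = a \<odot> (y \<oplus> z) \<oplus> (e x \<odot> y \<oplus> e x \<odot> z)"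
    unfolding xd[of y] xd[of z] ad by (simp only: add_ac)
  also have "\<dots> = x \<odot> (y \<oplus> z) \<oplus> e x \<odot> y \<oplus> e x \<odot> z"
    unfolding xd[of "y \<oplus> z"] by (simp only: add_assoc le)
  finally show ?thesis .
qed

lemma criterion_if_distributivity:
  assumes dist: "\<And>x y z. x \<odot> y \<oplus> x \<odot> z = x \<odot> (y \<oplus> z) \<oplus> e x \<odot> y \<oplus> e x \<odot> z"
  shows "x \<odot> y \<oplus> x \<odot> z = x \<odot> (y \<oplus> z) \<longleftrightarrow>
      (e x \<odot> (y \<oplus> z) = e x \<odot> y \<oplus> e x \<odot> z \<or>
       relunc add mul x \<preceq> relunc add mul y \<oplus> relunc add mul z)"
proof -
  interpret precise_distributive_solid
  proof unfold_locales
    fix x y z assume "e x = \<zero>" "e y = \<zero>" "e z = \<zero>"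
    then show "x \<odot> (y \<oplus> z) = x \<odot> y \<oplus> x \<odot> z"
      using dist[of x y z] by (simp add: zero_mul_precise precise_add)
  qed
  \<comment> \<open>By the axiom, exact distributivity means that the two extra magnitudes are
    absorbed.\<close>
  have "x \<odot> y \<oplus> x \<odot> z = x \<odot> (y \<oplus> z) \<longleftrightarrow> e x \<odot> y \<oplus> e x \<odot> z \<preceq> e (x \<odot> (y \<oplus> z))"
    unfolding dist[of x y z] add_assoc by (rule add_mag_absorb) (simp add: mag_add mag_mul_mag)
  also have "e (x \<odot> (y \<oplus> z)) = e x \<odot> (y \<oplus> z) \<oplus> (x \<odot> e y \<oplus> x \<odot> e z)"
    using mul_mag_add[of "e y" "e z" x] by (simp add: mag_mul mag_add mul_comm[of _ x])
  finally show ?thesis unfolding distrib_criterion_iff .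
qed

end

theorem mainTheorem2:
  fixes add mul :: "'a \<Rightarrow> 'a \<Rightarrow> 'a" and le :: "'a \<Rightarrow> 'a \<Rightarrow> bool"
  assumes "solid_wo_dist add mul le"
  shows "(\<forall>x y z. (add (mul x y) (mul x z) = mul x (add y z)) \<longleftrightarrow>
              (mul (mag add x) (add y z) = add (mul (mag add x) y) (mul (mag add x) z)
               \<or> le (relunc add mul x) (add (relunc add mul y) (relunc add mul z))))
     \<longleftrightarrow>
         (\<forall>x y z. add (mul x y) (mul x z) =
              add (add (mul x (add y z)) (mul (mag add x) y)) (mul (mag add x) z))"
proof -
  interpret predistributive_solid add mul le by unfold_locales (rule assms)
  show ?thesis using distributivity_if_criterion criterion_if_distributivity by (intro iffI allI) blast+
qed

end
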